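(* Let $M$ be a partially ordered monoid with a family of null sequences $N(M)$, let $(X,d_{X,M})$ be a partially ordered complete $FM$-distance space, and let $f\colon X\to X$ be a non-decreasing mapping (i.e. $x\le y$ implies $f(x)\le f(y)$) satisfying: whenever $x,a\in X$ and $f^n(x)\to a$ as $n\to\infty$, then $f(a)=a$. Let $\lambda\colon M_+\to M_+$ be non-decreasing. Assume that there exists $x_0\in X$ such that $x_0\leq f(x_0)$ and such that for the sequence $x_n=f(x_{n-1})$, $n\in\mathbb{N}$, one has $$d_{X,M}(x_n,x_{n+1})\leq\lambda(d_{X,M}(x_{n-1},x_n))\quad\text{for all } n\in\mathbb{N},$$ and $\sum_{n=1}^\infty\lambda^n(d_{X,M}(x_0,x_1))$ is a Cauchy series. Then $f$ has a fixed point, which is the limit of the sequence $\{x_n\}$.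
   Context: A monoid $M$ is a set with an associative binary operation $+$ (not assumed commutative) and a two-sided neutral element $\theta_M$. A partially ordered monoid is a monoid $M$ with a partial order $\le$ (reflexive, transitive, antisymmetric) such that $M_+:=\{x\in M:\theta_M\le x\}\neq\{\theta_M\}$ and $x_1\le y_1$, $x_2\le y_2$ imply $x_1+x_2\le y_1+y_2$. A family of null sequences $N(M)$ is a family of sequences in $M_+$ such that: (1) the constant sequence $\{\theta_M\}$ is in $N(M)$, and if a constant sequence $\{x,x,\ldots\}$, $x\in M_+$, is in $N(M)$ then $x=\theta_M$; (2) $\{x_n\},\{y_n\}\in N(M)$ implies $\{x_n+y_n\}\in N(M)$; (3) $\{x_n\}\in N(M)$ and $\theta_M\le y_n\le x_n$ for all $n\in\mathbb{N}$ imply $\{y_n\}\in N(M)$; (4) substitution, addition or removal of finitely many elements of a sequence of $N(M)$ (elements of $M_+$) preserves membership in $N(M)$; (5) each subsequence of a sequence of $N(M)$ is in $N(M)$. A family $N(M)$ is fixed. "Increasing" sequences of natural numbers are strictly increasing. $f^n$ and $\lambda^n$ denote $n$-fold iterates. For $\{x_n\}\subset M_+$, the series $\sum_{n=1}^\infty x_n$ is a Cauchy series if for all increasing sequences of natural numbers $\{n_k\},\{m_k\}$ with $m_k\ge n_k$ for all $k$ one has $\{\sum_{s=n_k}^{m_k}x_s\}_k\in N(M)$. An $M$-valued distance on a set $X$ is a map $d_{X,M}\colon X\times X\to M_+$ with $d_{X,M}(x,y)=d_{X,M}(y,x)$ and $d_{X,M}(x,y)=\theta_M\iff x=y$. Then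 $(X,d_{X,M})$ is an $M$-distance space. A sequence $\{x_n\}\subset X$ converges to $x\in X$ ($x_n\to x$) if $\{d_{X,M}(x_n,x)\}\in N(M)$; it is a Cauchy sequence if $\{d_{X,M}(x_{n_k},x_{m_k})\}_k\in N(M)$ for all increasing sequences of natural numbers $\{n_k\},\{m_k\}$ with $m_k>n_k$ for all $k$. $(X,d_{X,M})$ is an $FM$-distance space ($FM$-space) if it has the strong Fréchet–Wilson property: for every sequence $\{x_n\}\subset X$ and all increasing sequences of natural numbers $\{n_k\},\{m_k\}$ with $m_k>n_k$ for all $k$, $\{\sum_{s=n_k}^{m_k-1}d_{X,M}(x_s,x_{s+1})\}_k\in N(M)$ implies $\{d_{X,M}(x_{n_k},x_{m_k})\}_k\in N(M)$. It is complete if each Cauchy sequence converges to an element of $X$. It is partially ordered if $X$ is equipped with a partial order $\le$. *)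

theory Defs
  imports Main "HOL-Library.FuncSet"
begin

text \<open>
  The monoid is written additively but is not assumed commutative, so finite sums are
  taken in order, with \<^const>\<open>sum_list\<close> over an interval of indices.  The set of elements
  above the neutral element is \<open>{0..}\<close>.  Sequences are indexed by \<^typ>\<open>nat\<close>, starting at 0.
\<close>

class partially_ordered_monoid = monoid_add + order +
  assumes add_mono_le: "x1 \<le> y1 \<Longrightarrow> x2 \<le> y2 \<Longrightarrow> x1 + x2 \<le> y1 + y2"
    and nonneg_nontrivial: "{0..} \<noteq> {0}"

text \<open>
  A map \<open>r\<close> that is strictly increasing and misses only finitely many indices
  exhibits \<open>x \<circ> r\<close> as obtained from \<open>x\<close> by removing finitely many elements, and \<open>x\<close> as
  obtained from \<open>x \<circ> r\<close> by adding finitely many elements.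
\<close>

locale null_sequence_family =
  fixes N :: "(nat \<Rightarrow> 'm::partially_ordered_monoid) set"
  assumes nonneg: "x \<in> N \<Longrightarrow> 0 \<le> x n"
    and zero: "(\<lambda>_. 0) \<in> N"
    and const: "0 \<le> c \<Longrightarrow> (\<lambda>_. c) \<in> N \<Longrightarrow> c = 0"
    and add: "x \<in> N \<Longrightarrow> y \<in> N \<Longrightarrow> (\<lambda>n. x n + y n) \<in> N"
    and dominated: "x \<in> N \<Longrightarrow> (\<And>n. 0 \<le> y n) \<Longrightarrow> (\<And>n. y n \<le> x n) \<Longrightarrow> y \<in> N"
    and substitution: "x \<in> N \<Longrightarrow> (\<And>n. 0 \<le> y n) \<Longrightarrow> finite {n. y n \<noteq> x n} \<Longrightarrow> y \<in> N"
    and addition: "y \<circ> r \<in> N \<Longrightarrow> strict_mono r \<Longrightarrow> finite (- range r) \<Longrightarrow>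
      (\<And>n. 0 \<le> y n) \<Longrightarrow> y \<in> N"
    and removal: "x \<in> N \<Longrightarrow> strict_mono r \<Longrightarrow> finite (- range r) \<Longrightarrow> x \<circ> r \<in> N"
    and subsequence: "x \<in> N \<Longrightarrow> strict_mono r \<Longrightarrow> x \<circ> r \<in> N"

definition Cauchy_series ::
    "(nat \<Rightarrow> 'm) set \<Rightarrow> (nat \<Rightarrow> 'm::partially_ordered_monoid) \<Rightarrow> bool" where
  "Cauchy_series N x \<longleftrightarrow>
    (\<forall>n m :: nat \<Rightarrow> nat. strict_mono n \<longrightarrow> strict_mono m \<longrightarrow> (\<forall>k. n k \<le> m k) \<longrightarrow>
      (\<lambda>k. sum_list (map x [n k..<Suc (m k)])) \<in> N)"

locale distance_space =
  fixes d :: "'x \<Rightarrow> 'x \<Rightarrow> 'm::partially_ordered_monoid"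
  assumes nonneg: "0 \<le> d x y"
    and sym: "d x y = d y x"
    and zero_iff: "d x y = 0 \<longleftrightarrow> x = y"

definition converges_to ::
    "(nat \<Rightarrow> 'm) set \<Rightarrow> ('x \<Rightarrow> 'x \<Rightarrow> 'm::partially_ordered_monoid) \<Rightarrow> (nat \<Rightarrow> 'x) \<Rightarrow> 'x \<Rightarrow> bool"
  where "converges_to N d x a \<longleftrightarrow> (\<lambda>n. d (x n) a) \<in> N"

definition Cauchy_sequence ::
    "(nat \<Rightarrow> 'm) set \<Rightarrow> ('x \<Rightarrow> 'x \<Rightarrow> 'm::partially_ordered_monoid) \<Rightarrow> (nat \<Rightarrow> 'x) \<Rightarrow> bool" where
  "Cauchy_sequence N d x \<longleftrightarrow>
    (\<forall>n m :: nat \<Rightarrow> nat. strict_mono n \<longrightarrow> strict_mono m \<longrightarrow> (\<forall>k. n k < m k) \<longrightarrow>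
      (\<lambda>k. d (x (n k)) (x (m k))) \<in> N)"

definition strong_Frechet_Wilson ::
    "(nat \<Rightarrow> 'm) set \<Rightarrow> ('x \<Rightarrow> 'x \<Rightarrow> 'm::partially_ordered_monoid) \<Rightarrow> bool" where
  "strong_Frechet_Wilson N d \<longleftrightarrow>
    (\<forall>x :: nat \<Rightarrow> 'x. \<forall>n m :: nat \<Rightarrow> nat.
      strict_mono n \<longrightarrow> strict_mono m \<longrightarrow> (\<forall>k. n k < m k) \<longrightarrow>
      (\<lambda>k. sum_list (map (\<lambda>s. d (x s) (x (Suc s))) [n k..<m k])) \<in> N \<longrightarrow>
      (\<lambda>k. d (x (n k)) (x (m k))) \<in> N)"

locale FM_distance_space = null_sequence_family N + distance_space d
  for N :: "(nat \<Rightarrow> 'm::partially_ordered_monoid) set" and d :: "'x \<Rightarrow> 'x \<Rightarrow> 'm" +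
  assumes Frechet_Wilson: "strong_Frechet_Wilson N d"

locale complete_FM_distance_space = FM_distance_space N d
  for N :: "(nat \<Rightarrow> 'm::partially_ordered_monoid) set" and d :: "'x \<Rightarrow> 'x \<Rightarrow> 'm" +
  assumes complete: "Cauchy_sequence N d x \<Longrightarrow> \<exists>a. converges_to N d x a"

end

theory Submission
  imports Defs
begin

text \<open>
  The iterates of \<open>\<lambda>\<close> dominate the consecutive distances of the orbit \<open>x\<close>, hence blocks of
  consecutive distances are dominated by blocks of the given Cauchy series. The strong
  Frechet-Wilson property then makes the orbit a Cauchy sequence, and the limit that
  completeness provides is fixed by the assumption on limits of orbits.
\<close>

lemma sum_list_mono_pom:
  fixes g h :: "'a \<Rightarrow> 'm::partially_ordered_monoid"
  assumes "\<And>s. s \<in> set xs \<Longrightarrow> g s \<le> h s"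
  shows "sum_list (map g xs) \<le> sum_list (map h xs)"
  using assms by (induction xs) (auto intro: add_mono_le)

lemma sum_list_nonneg_pom:
  fixes g :: "'a \<Rightarrow> 'm::partially_ordered_monoid"
  assumes "\<And>s. 0 \<le> g s"
  shows "0 \<le> sum_list (map g xs)"
  using sum_list_mono_pom[of xs "\<lambda>_. 0" g] assms by simp

text \<open>Induction on \<open>n\<close>. Monotonicity of \<open>lam\<close> is given only on
  \<open>{0..}\<close>, so the step needs the iterate to be nonnegative; it is, since it lies above
  \<open>e n\<close> by the induction hypothesis.\<close>

lemma iterate_dominates:
  fixes lam :: "'m::partially_ordered_monoid \<Rightarrow> 'm"
  assumes lam: "mono_on {0..} lam"
    and e: "\<And>n. 0 \<le> e n" "\<And>n. e (Suc n) \<le> lam (e n)"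
  shows "e n \<le> (lam ^^ n) (e 0)"
proof (induction n)
  case (Suc n)
  have "0 \<le> (lam ^^ n) (e 0)"
    using e(1)[of n] Suc by (rule order_trans)
  then have "lam (e n) \<le> lam ((lam ^^ n) (e 0))"
    using lam Suc e(1) by (auto simp: mono_on_def)
  with e(2)[of n] show ?case by simp
qed simp

text \<open>The shift by one matches a series that begins with the first iterate of
  \<open>lam\<close>. The bound says nothing about \<open>d (x 0) (x 1)\<close>, so a block starting
  at index 0 has to be avoided.\<close>

lemma (in FM_distance_space) Cauchy_sequence_if_dominated:
  assumes dom: "\<And>s. d (x (Suc s)) (x (Suc (Suc s))) \<le> b s"
    and b: "Cauchy_series N b"
  shows "Cauchy_sequence N d x"
  unfolding Cauchy_sequence_def
proof (intro allI impI)
  fix n m :: "nat \<Rightarrow> nat"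
  assume n: "strict_mono n" and m: "strict_mono m" and nm: "\<forall>k. n k < m k"
  \<comment> \<open>Passing to \<open>Suc k\<close> forces \<open>n (Suc k) \<ge> 1\<close> and
    \<open>m (Suc k) \<ge> 2\<close>, so neither subtraction is truncated. One unit undoes the index
    shift in \<open>dom\<close>; the second one in \<open>q\<close> appears because blocks in
    \<open>Cauchy_series\<close> include their right endpoint.\<close>
  define p where "p k = n (Suc k) - 1" for k
  define q where "q k = m (Suc k) - 2" for k
  have n_Suc: "n (Suc k) = Suc (p k)" for k
    using strict_monoD[OF n, of k "Suc k"] by (simp add: p_def)
  have m_Suc: "m (Suc k) = Suc (Suc (q k))" for k
    using n_Suc[of k] nm[rule_format, of "Suc k"] by (simp add: q_def)
  have n': "strict_mono (n \<circ> Suc)" and m': "strict_mono (m \<circ> Suc)"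
    using n m by (auto simp: strict_mono_Suc_iff)
  have p: "strict_mono p" and q: "strict_mono q"
    using n' m' by (auto simp: strict_mono_Suc_iff n_Suc m_Suc)
  have pq: "\<forall>k. p k \<le> q k"
  proof
    show "p k \<le> q k" for k
      using nm[rule_format, of "Suc k"] by (simp add: n_Suc m_Suc)
  qed
  let ?D = "\<lambda>s. d (x s) (x (Suc s))"
  have block: "sum_list (map ?D [n (Suc k)..<m (Suc k)])
      \<le> sum_list (map b [p k..<Suc (q k)])" for k
  proof -
    have "map ?D [n (Suc k)..<m (Suc k)] = map (?D \<circ> Suc) [p k..<Suc (q k)]"
      unfolding n_Suc m_Suc map_Suc_upt[symmetric] by simp
    then show ?thesis
      using dom by (simp only: comp_def) (rule sum_list_mono_pom)
  qed
  have "(\<lambda>k. sum_list (map b [p k..<Suc (q k)])) \<in> N"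
    using b p q pq unfolding Cauchy_series_def by blast
  then have "(\<lambda>k. sum_list (map ?D [(n \<circ> Suc) k..<(m \<circ> Suc) k])) \<in> N"
    by (rule dominated) (simp_all add: sum_list_nonneg_pom distance_space.nonneg
        distance_space_axioms block del: upt_Suc)
  then have "(\<lambda>k. d (x ((n \<circ> Suc) k)) (x ((m \<circ> Suc) k))) \<in> N"
    using Frechet_Wilson[unfolded strong_Frechet_Wilson_def, rule_format, OF n' m'] nm
    by simp
  then have tail: "(\<lambda>k. d (x (n k)) (x (m k))) \<circ> Suc \<in> N"
    by (simp add: comp_def)
  \<comment> \<open>Only the term at \<open>k = 0\<close> was dropped, and adding finitely many
    terms preserves null sequences.\<close>
  have "- range Suc = {0}"
    using not0_implies_Suc by force
  then show "(\<lambda>k. d (x (n k)) (x (m k))) \<in> N"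
    using addition[OF tail] by (simp add: strict_mono_Suc_iff distance_space.nonneg
        distance_space_axioms)
qed

theorem theorem4:
  fixes N :: "(nat \<Rightarrow> 'm::partially_ordered_monoid) set"
    and d :: "'x::order \<Rightarrow> 'x \<Rightarrow> 'm"
    and f :: "'x \<Rightarrow> 'x"
    and lam :: "'m \<Rightarrow> 'm"
    and x :: "nat \<Rightarrow> 'x"
  assumes "null_sequence_family N"
    and "complete_FM_distance_space N d"
    and "mono f"
    and "\<And>y a. converges_to N d (\<lambda>n. (f ^^ n) y) a \<Longrightarrow> f a = a"
    and "lam \<in> {0..} \<rightarrow> {0..}"
    and "mono_on {0..} lam"
    and "x 0 \<le> f (x 0)"
    and "\<And>n. n \<ge> 1 \<Longrightarrow> x n = f (x (n - 1))"
    and "\<And>n. n \<ge> 1 \<Longrightarrow> d (x n) (x (n + 1)) \<le> lam (d (x (n - 1)) (x n))"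
    and "Cauchy_series N (\<lambda>n. (lam ^^ (n + 1)) (d (x 0) (x 1)))"
  shows "\<exists>a. f a = a \<and> converges_to N d x a"
proof -
  interpret complete_FM_distance_space N d by fact
  let ?e = "\<lambda>n. d (x n) (x (Suc n))"
  have d_nonneg: "0 \<le> d y z" for y z
    by (rule distance_space.nonneg) (rule distance_space_axioms)
  have step: "?e (Suc n) \<le> lam (?e n)" for n
    using assms(9)[of "Suc n"] by simp
  have dom: "?e n \<le> (lam ^^ n) (?e 0)" for n
    by (rule iterate_dominates[of lam ?e]) (fact assms(6) d_nonneg step)+
  have "Cauchy_sequence N d x"
  proof (rule Cauchy_sequence_if_dominated)
    \<comment> \<open>The series starts at the first power of \<open>lam\<close>, hence
      \<open>dom\<close> is taken at \<open>Suc s\<close>.\<close>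
    show "d (x (Suc s)) (x (Suc (Suc s))) \<le> (lam ^^ (s + 1)) (d (x 0) (x 1))" for s
      using dom[of "Suc s"] by simp
  qed (fact assms(10))
  then obtain a where a: "converges_to N d x a"
    using complete by blast
  \<comment> \<open>The assumption on limits speaks of iterates of \<open>f\<close>, so
    \<open>x\<close> is rewritten as the orbit of \<open>x 0\<close>.\<close>
  have "(f ^^ n) (x 0) = x n" for n
  proof (induction n)
    case (Suc n)
    then show ?case
      using assms(8)[of "Suc n"] by simp
  qed simp
  then have "f a = a"
    using assms(4)[of "x 0" a] a by simp
  with a show ?thesis
    by blast
qed

end
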